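(* Let $\mathcal X\subset\mathbb R^d$ be a compact convex set. Then the distributionally robust optimization problem $$\min_{x\in\mathcal X}\ \sup_{p\in\mathcal P_{\rho,n}}\ \sum_{i=1}^np_i\,g(b_ia_i^Tx)$$ is equivalent (in the sense that the optimal values coincide) to $$\begin{aligned}\min_{x,u,v,w,\mu,q,\gamma}\quad&\gamma+\frac{\rho\mu_1}n+\frac1n\sum_{i=1}^n\mu_if^*\Big(\frac{q_i}{\mu_i}\Big)\\ \text{s.t.}\quad&w+v-q-\gamma\mathbf 1_n=\mathbf 0_n,\\&u_i=b_ia_i^Tx,\quad i\in[n],\\&\mu_1=\mu_2=\cdots=\mu_n,\\&g(u_i)\le w_i,\quad i\in[n],\\&q_i\in\mu_i\,\mathrm{dom}(f^* ),\quad i\in[n],\\&v_i\ge0,\ \mu_i\ge0,\quad i\in[n],\\&x\in\mathcal X,\end{aligned}$$ where $u,v,w,\mu,q\in\mathbb R^n$ and $\gamma\in\mathbb R$.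
   Context: $a_1,\dots,a_n\in\mathbb R^d$ are sample vectors with labels $b_1,\dots,b_n\in\{1,-1\}$, $g:\mathbb R\to\mathbb R$ is a convex loss function, and the ambiguity set is $$\mathcal P_{\rho,n}=\Big\{p\in\mathbb R^n:\sum_{i=1}^np_i=1,\ p_i\ge0\ (i\in[n]),\ D_f(p\|\mathbf 1/n)\le\frac\rho n\Big\},$$ where $D_f(p\|q)=\sum_{i=1}^nq_if(p_i/q_i)$ is the $f$-divergence of a convex function $f$ (proper, lower semicontinuous, $f:\mathbb R\to\mathbb R\cup\{+\infty\}$), $\rho$ is the radius parameter, and $\mathbf 1/n$ is the uniform distribution. $f^*(y)=\sup_{x\in\mathbb R}\{yx-f(x)\}$ is the convex conjugate and $\mathrm{dom}(f^* )=\{y:f^*(y)<+\infty\}$. $\mathbf 1_n$ and $\mathbf 0_n$ are the all-ones and all-zeros vectors in $\mathbb R^n$. When $\mu_i=0$, the constraint $q_i\in\mu_i\,\mathrm{dom}(f^* )$ forces $q_i=0$ and the term $\mu_if^*(q_i/\mu_i)$ is read as $0$. *)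

theory Defs
  imports "HOL-Analysis.Analysis"
begin

text \<open>
  Extended-real-valued functions on the line. In \<^typ>\<open>ereal\<close> we have \<open>0 * \<infinity> = 0\<close>, so in the
  convexity inequality the endpoints \<open>t = 0, 1\<close> are harmless. The inequality is meaningful for
  functions that do not take the value \<open>-\<infinity>\<close>, which \<open>proper_fun\<close> guarantees.
\<close>

definition proper_fun :: "(real \<Rightarrow> ereal) \<Rightarrow> bool" where
  "proper_fun f \<longleftrightarrow> (\<forall>x. f x \<noteq> -\<infinity>) \<and> (\<exists>x. f x \<noteq> \<infinity>)"

definition convex_fun :: "(real \<Rightarrow> ereal) \<Rightarrow> bool" where
  "convex_fun f \<longleftrightarrow> (\<forall>x y t. 0 \<le> t \<and> t \<le> 1 \<longrightarrow>
     f ((1 - t) * x + t * y) \<le> ereal (1 - t) * f x + ereal t * f y)"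

definition lsc_fun :: "(real \<Rightarrow> ereal) \<Rightarrow> bool" where
  "lsc_fun f \<longleftrightarrow> (\<forall>x. f x \<le> Liminf (at x) f)"

definition conjugate :: "(real \<Rightarrow> ereal) \<Rightarrow> real \<Rightarrow> ereal" where
  "conjugate f y = (SUP x. ereal (y * x) - f x)"

definition edom :: "(real \<Rightarrow> ereal) \<Rightarrow> real set" where
  "edom h = {y. h y < \<infinity>}"

definition f_divergence :: "(real \<Rightarrow> ereal) \<Rightarrow> real ^ 'n \<Rightarrow> real ^ 'n \<Rightarrow> ereal" where
  "f_divergence f p q = (\<Sum>i\<in>UNIV. ereal (q $ i) * f (p $ i / q $ i))"

definition ambiguity_set :: "(real \<Rightarrow> ereal) \<Rightarrow> real \<Rightarrow> (real ^ 'n) set" where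
  "ambiguity_set f \<rho> = {p. (\<Sum>i\<in>UNIV. p $ i) = 1 \<and> (\<forall>i. 0 \<le> p $ i) \<and>
     f_divergence f p (\<chi> i. 1 / real CARD('n)) \<le> ereal (\<rho> / real CARD('n))}"

text \<open>The term \<open>m h(t/m)\<close>, read as \<open>0\<close> for \<open>m = 0\<close>.\<close>

definition scaled :: "(real \<Rightarrow> ereal) \<Rightarrow> real \<Rightarrow> real \<Rightarrow> ereal" where
  "scaled h m t = (if m = 0 then 0 else ereal m * h (t / m))"

end

theory Submission
  imports Defs
begin

text \<open>
  Fix \<open>x\<close>; only the vector of losses \<open>z\<^sub>i = g(b\<^sub>i a\<^sub>i \<bullet> x)\<close> then matters, and the claim becomes
  Lagrangian duality for the maximization of \<open>p \<bullet> z\<close> over the ambiguity set. The multiplier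
  \<open>\<gamma>\<close> belongs to \<open>\<Sum>p = 1\<close>, the common value \<open>m\<close> of the \<open>\<mu>\<^sub>i\<close> to the divergence constraint, and
  \<open>v\<close> to \<open>p \<ge> 0\<close>; maximizing the Lagrangian coordinate by coordinate over
  \<open>t\<^sub>i = n p\<^sub>i\<close> produces \<open>m f\<^sup>*(q\<^sub>i / m)\<close> with \<open>q = w + v - \<gamma>\<close>. The variable \<open>w\<close> only relaxes \<open>z\<close>,
  so \<open>w = z\<close> may be taken.

  That dual values dominate primal values is the Fenchel--Young inequality
  (\<open>weak_duality\<close>). In the other direction no Slater point is available: the ambiguity set may
  be empty or have empty relative interior. What replaces it is compactness. The constraints
  \<open>p \<ge> 0\<close> and \<open>\<Sum>p = 1\<close>, even when perturbed, bound \<open>p\<close>, and an affine minorant of \<open>f\<close> then bounds the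
  values of \<open>f\<close>; hence the set of perturbations for which the
  system ``feasible with objective at least \<open>L\<close>'' is solvable is closed (\<open>closed_perturbations\<close>),
  besides being convex. If \<open>L\<close> exceeds the primal supremum, the unperturbed point lies outside this
  set and is separated from it strictly, with a gap \<open>c > 0\<close> (\<open>separating_multipliers\<close>).

  The separating functional may give weight zero to the objective or to the divergence. The gap
  pays for the repair: adding a small multiple of a functional that has both weights equal to one
  and is bounded below over all \<open>t\<close> with finite \<open>f(t\<^sub>i)\<close> makes both weights positive, so that the functional
  can be normalized (\<open>normalized_multipliers\<close>). Hence multipliers with \<open>m > 0\<close> alone approach the
  primal value, and the convention for \<open>m = 0\<close> has only to respect weak duality, which it does.
\<close>

section \<open>Epigraphs and conjugates of functions on the line\<close>

definition epi :: "(real \<Rightarrow> ereal) \<Rightarrow> (real \<times> real) set" where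
  "epi f = {(x, r). f x \<le> ereal r}"

lemma mem_epi [simp]: "(x, r) \<in> epi f \<longleftrightarrow> f x \<le> ereal r"
  by (simp add: epi_def)

lemma closed_epi:
  assumes "lsc_fun f"
  shows "closed (epi f)"
  unfolding closed_sequential_limits
proof (intro allI impI)
  fix X l assume X: "(\<forall>k. X k \<in> epi f) \<and> X \<longlonglongrightarrow> l"
  obtain x r where l: "l = (x, r)" by (cases l)
  have Xf: "f (fst (X k)) \<le> ereal (snd (X k))" for k
    using X by (metis mem_epi prod.collapse)
  have x_lim: "(\<lambda>k. fst (X k)) \<longlonglongrightarrow> x" and r_lim: "(\<lambda>k. snd (X k)) \<longlonglongrightarrow> r"
    using X tendsto_fst[of X l] tendsto_snd[of X l] by (auto simp: l)
  have "f x \<le> ereal r"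
  proof (rule ccontr)
    assume "\<not> f x \<le> ereal r"
    then obtain c where c: "ereal r < ereal c" "ereal c < f x"
      using ereal_dense2[of "ereal r" "f x"] unfolding not_le by metis
    have "f x \<le> Liminf (at x) f"
      using assms by (simp add: lsc_fun_def)
    with c(2) have "eventually (\<lambda>y. ereal c < f y) (at x)"
      by (simp add: le_Liminf_iff)
    with c(2) have "eventually (\<lambda>y. ereal c < f y) (nhds x)"
      by (auto simp: eventually_at_filter elim: eventually_mono)
    then have 1: "eventually (\<lambda>k. ereal c < f (fst (X k))) sequentially"
      using x_lim by (auto simp: filterlim_iff)
    have 2: "eventually (\<lambda>k. snd (X k) < c) sequentially"
      using r_lim c(1) by (intro order_tendstoD(2)[OF r_lim]) simp
    from eventually_conj[OF 1 2] obtain k where "ereal c < f (fst (X k))" "snd (X k) < c"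
      by (auto simp: eventually_sequentially)
    with Xf[of k] show False
      by (metis ereal_less_eq(3) linorder_not_le order.strict_trans1 order_less_imp_le leD)
  qed
  then show "l \<in> epi f" by (simp add: l)
qed

lemma convex_fun_le_chord:
  assumes "convex_fun f" "f x \<le> ereal r" "f y \<le> ereal s" "0 \<le> t" "t \<le> 1"
  shows "f ((1 - t) * x + t * y) \<le> ereal ((1 - t) * r + t * s)"
proof -
  have "f ((1 - t) * x + t * y) \<le> ereal (1 - t) * f x + ereal t * f y"
    using assms by (simp add: convex_fun_def)
  also have "\<dots> \<le> ereal (1 - t) * ereal r + ereal t * ereal s"
    using assms by (intro add_mono ereal_mult_left_mono) auto
  finally show ?thesis by simp
qed

lemma convex_epi:
  assumes "convex_fun f"
  shows "convex (epi f)"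
  unfolding convex_alt
  using convex_fun_le_chord[OF assms] by auto

lemma proper_fun_finite_value:
  assumes "proper_fun f"
  obtains x r where "f x = ereal r"
  using assms by (metis proper_fun_def ereal_cases)

text \<open>
  The point just below the graph over some \<open>x0\<close> in the domain is separated from the epigraph, and
  the separating line cannot be vertical because it passes between two points over \<open>x0\<close>.
\<close>

lemma affine_minorant:
  assumes "proper_fun f" "convex_fun f" "lsc_fun f"
  obtains y c where "\<And>x r. f x \<le> ereal r \<Longrightarrow> y * x - c \<le> r"
proof -
  obtain x0 r0 where x0: "f x0 = ereal r0"
    using proper_fun_finite_value[OF assms(1)] .
  have "(x0, r0 - 1) \<notin> epi f" by (simp add: x0)
  then obtain a b where ab: "a \<bullet> (x0, r0 - 1) < b" "\<forall>p\<in>epi f. b < a \<bullet> p"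
    using separating_hyperplane_closed_point[OF convex_epi[OF assms(2)] closed_epi[OF assms(3)]]
    by blast
  obtain \<alpha> \<beta> where a: "a = (\<alpha>, \<beta>)" by (cases a)
  have sep: "b < \<alpha> * x + \<beta> * r" if "f x \<le> ereal r" for x r
    using ab(2)[rule_format, of "(x, r)"] that by (simp add: a)
  have "\<alpha> * x0 + \<beta> * (r0 - 1) < b" using ab(1) by (simp add: a)
  with sep[of x0 r0] x0 have \<beta>: "\<beta> > 0" by (simp add: algebra_simps)
  have "(- \<alpha> / \<beta>) * x - (- b / \<beta>) \<le> r" if "f x \<le> ereal r" for x r
    using sep[OF that] \<beta> by (simp add: field_simps)
  then show ?thesis by (rule that)
qed

lemma conjugate_ge:
  assumes "f x \<le> ereal r"
  shows "ereal (y * x - r) \<le> conjugate f y"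
proof -
  have "ereal (y * x - r) \<le> ereal (y * x) - f x"
    using ereal_minus_mono[OF order_refl assms, of "ereal (y * x)"] by simp
  also have "\<dots> \<le> conjugate f y"
    unfolding conjugate_def by (rule SUP_upper) simp
  finally show ?thesis .
qed

lemma conjugate_le:
  assumes "proper_fun f" "\<And>x r. f x = ereal r \<Longrightarrow> y * x - r \<le> c"
  shows "conjugate f y \<le> ereal c"
  unfolding conjugate_def
proof (rule SUP_least)
  fix x
  show "ereal (y * x) - f x \<le> ereal c"
    using assms by (cases "f x") (auto simp: proper_fun_def)
qed

text \<open>
  The supremum of a separable function over a product is the sum of the suprema. A bound on the
  joint expression thus both makes every single conjugate finite, by freezing all other
  coordinates at a point of the domain, and bounds their sum.
\<close>

lemma sum_conjugate_le:
  fixes y :: "real ^ 'n"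
  assumes proper: "proper_fun f"
    and bound: "\<And>t h :: real ^ 'n. (\<And>i. f (t $ i) \<le> ereal (h $ i)) \<Longrightarrow>
                  (\<Sum>i\<in>UNIV. y $ i * t $ i - h $ i) \<le> B"
  obtains F :: "real ^ 'n" where "\<And>i. conjugate f (y $ i) = ereal (F $ i)" "(\<Sum>i\<in>UNIV. F $ i) \<le> B"
proof -
  obtain x0 r0 where x0: "f x0 = ereal r0"
    using proper_fun_finite_value[OF proper] .
  have fin: "\<exists>F. conjugate f (y $ j) = ereal F" for j
  proof -
    \<comment> \<open>all coordinates but \<open>j\<close> are frozen at \<open>x0\<close>\<close>
    let ?c = "B - (\<Sum>i\<in>UNIV - {j}. y $ i * x0 - r0)"
    have "conjugate f (y $ j) \<le> ereal ?c"
    proof (rule conjugate_le[OF proper])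
      fix x r assume xr: "f x = ereal r"
      let ?t = "(\<chi> i. if i = j then x else x0) :: real ^ 'n"
      let ?h = "(\<chi> i. if i = j then r else r0) :: real ^ 'n"
      have "(\<Sum>i\<in>UNIV. y $ i * ?t $ i - ?h $ i) \<le> B"
        by (rule bound) (simp add: x0 xr)
      moreover have "(\<Sum>i\<in>UNIV. y $ i * ?t $ i - ?h $ i)
          = (y $ j * ?t $ j - ?h $ j) + (\<Sum>i\<in>UNIV - {j}. y $ i * ?t $ i - ?h $ i)"
        by (rule sum.remove) simp_all
      moreover have "(\<Sum>i\<in>UNIV - {j}. y $ i * ?t $ i - ?h $ i) = (\<Sum>i\<in>UNIV - {j}. y $ i * x0 - r0)"
        by (rule sum.cong) auto
      ultimately show "y $ j * x - r \<le> ?c" by simp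
    qed
    moreover have "ereal (y $ j * x0 - r0) \<le> conjugate f (y $ j)"
      by (rule conjugate_ge) (simp add: x0)
    ultimately show ?thesis
      by (cases "conjugate f (y $ j)") auto
  qed
  define F where "F = (\<chi> j. real_of_ereal (conjugate f (y $ j)))"
  have F: "conjugate f (y $ j) = ereal (F $ j)" for j
    using fin[of j] by (auto simp: F_def)
  have "(\<Sum>i\<in>UNIV. F $ i) \<le> B"
  proof (rule field_le_epsilon)
    fix e :: real assume e: "e > 0"
    define d where "d = e / real CARD('n)"
    have d: "d > 0" using e by (simp add: d_def)
    have "\<exists>x r. f x = ereal r \<and> F $ i - d < y $ i * x - r" for i
    proof (rule ccontr)
      assume "\<not> ?thesis"
      then have "conjugate f (y $ i) \<le> ereal (F $ i - d)"
        by (intro conjugate_le[OF proper]) (force simp: not_less)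
      then show False using d by (simp add: F)
    qed
    then obtain t h where th: "\<And>i. f (t i) = ereal (h i)" "\<And>i. F $ i - d < y $ i * t i - h i"
      by metis
    have "(\<Sum>i\<in>UNIV. F $ i - d) \<le> (\<Sum>i\<in>UNIV. y $ i * (\<chi> i. t i) $ i - (\<chi> i. h i) $ i)"
      using th(2) by (intro sum_mono) (simp add: less_imp_le)
    also have "\<dots> \<le> B" by (rule bound) (simp add: th)
    finally show "(\<Sum>i\<in>UNIV. F $ i) \<le> B + e"
      by (simp add: sum_subtractf d_def)
  qed
  with F show ?thesis by (rule that)
qed

section \<open>The perturbed constraint system\<close>

text \<open>
  The right-hand sides \<open>(s, r, l, e)\<close> for which the system \<open>\<Sum>t = s\<close>, \<open>\<Sum>f(t\<^sub>i) \<le> r\<close>,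
  \<open>t \<bullet> z \<ge> l\<close>, \<open>t \<ge> e\<close> is solvable. Real upper bounds \<open>h\<^sub>i\<close> of the values \<open>f(t\<^sub>i)\<close> keep extended-real
  arithmetic out of the convexity and closedness arguments. With \<open>n\<close> the number of coordinates, the point
  \<open>(n, \<rho>, n L, 0)\<close> says that some \<open>p = t/n\<close> in the ambiguity set satisfies \<open>p \<bullet> z \<ge> L\<close>.
\<close>

definition perturbations ::
    "(real \<Rightarrow> ereal) \<Rightarrow> real ^ 'n \<Rightarrow> (real \<times> real \<times> real \<times> (real ^ 'n)) set" where
  "perturbations f z = {(s, r, l, e). \<exists>t h.
     (\<forall>i. f (t $ i) \<le> ereal (h $ i)) \<and> s = (\<Sum>i\<in>UNIV. t $ i) \<and> (\<Sum>i\<in>UNIV. h $ i) \<le> r \<and>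
     l \<le> t \<bullet> z \<and> (\<forall>i. e $ i \<le> t $ i)}"

lemma perturbationsI:
  assumes "\<And>i. f (t $ i) \<le> ereal (h $ i)" "s = (\<Sum>i\<in>UNIV. t $ i)" "(\<Sum>i\<in>UNIV. h $ i) \<le> r"
    "l \<le> t \<bullet> z" "\<And>i. e $ i \<le> t $ i"
  shows "(s, r, l, e) \<in> perturbations f z"
  using assms by (auto simp: perturbations_def)

lemma perturbationsE:
  assumes "p \<in> perturbations f z"
  obtains s r l e t h where "p = (s, r, l, e)" "\<And>i. f (t $ i) \<le> ereal (h $ i)"
    "s = (\<Sum>i\<in>UNIV. t $ i)" "(\<Sum>i\<in>UNIV. h $ i) \<le> r" "l \<le> t \<bullet> z" "\<And>i. e $ i \<le> t $ i"
  using assms unfolding perturbations_def by blast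

lemma convex_perturbations:
  assumes "convex_fun f"
  shows "convex (perturbations f z)"
  unfolding convex_alt
proof (intro ballI allI impI)
  fix p p' and c :: real
  assume p: "p \<in> perturbations f z" and p': "p' \<in> perturbations f z" and c: "0 \<le> c \<and> c \<le> 1"
  obtain s r l e t h where P: "p = (s, r, l, e)" "\<And>i. f (t $ i) \<le> ereal (h $ i)"
      "s = (\<Sum>i\<in>UNIV. t $ i)" "(\<Sum>i\<in>UNIV. h $ i) \<le> r" "l \<le> t \<bullet> z" "\<And>i. e $ i \<le> t $ i"
    using p by (rule perturbationsE) blast
  obtain s' r' l' e' t' h' where P': "p' = (s', r', l', e')"
      "\<And>i. f (t' $ i) \<le> ereal (h' $ i)"
      "s' = (\<Sum>i\<in>UNIV. t' $ i)" "(\<Sum>i\<in>UNIV. h' $ i) \<le> r'" "l' \<le> t' \<bullet> z" "\<And>i. e' $ i \<le> t' $ i"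
    using p' by (rule perturbationsE) blast
  have "((1 - c) * s + c * s', (1 - c) * r + c * r', (1 - c) * l + c * l',
          (1 - c) *\<^sub>R e + c *\<^sub>R e') \<in> perturbations f z"
  proof (rule perturbationsI)
    fix i
    show "f (((1 - c) *\<^sub>R t + c *\<^sub>R t') $ i) \<le> ereal (((1 - c) *\<^sub>R h + c *\<^sub>R h') $ i)"
      using convex_fun_le_chord[OF assms P(2) P'(2)] c by simp
    show "((1 - c) *\<^sub>R e + c *\<^sub>R e') $ i \<le> ((1 - c) *\<^sub>R t + c *\<^sub>R t') $ i"
      using c P(6) P'(6) by (simp add: add_mono mult_left_mono)
  next
    show "(1 - c) * s + c * s' = (\<Sum>i\<in>UNIV. ((1 - c) *\<^sub>R t + c *\<^sub>R t') $ i)"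
      by (simp add: P P' sum.distrib sum_distrib_left)
    show "(\<Sum>i\<in>UNIV. ((1 - c) *\<^sub>R h + c *\<^sub>R h') $ i) \<le> (1 - c) * r + c * r'"
      using c P(4) P'(4) by (simp add: sum.distrib add_mono mult_left_mono flip: sum_distrib_left)
    show "(1 - c) * l + c * l' \<le> ((1 - c) *\<^sub>R t + c *\<^sub>R t') \<bullet> z"
      using c P(5) P'(5) by (simp add: inner_add_left add_mono mult_left_mono)
  qed
  then show "(1 - c) *\<^sub>R p + c *\<^sub>R p' \<in> perturbations f z"
    by (simp add: P(1) P'(1))
qed

text \<open>
  Each coordinate is bounded above because the others cannot compensate it below \<open>-m\<close>. This is
  the source of compactness, both for the weights and for the values of \<open>f\<close>.
\<close>

lemma norm_le_of_lower_bound_and_sum: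
  fixes t :: "real ^ 'n"
  assumes "\<And>i. - m \<le> t $ i" "(\<Sum>i\<in>UNIV. t $ i) \<le> M" "0 \<le> m"
  shows "norm t \<le> real CARD('n) * (\<bar>M\<bar> + real CARD('n) * m)"
proof -
  have "\<bar>t $ j\<bar> \<le> \<bar>M\<bar> + real CARD('n) * m" for j
  proof -
    have "0 \<le> t $ i + m" for i
      using assms(1)[of i] by linarith
    then have "t $ j + m \<le> (\<Sum>i\<in>UNIV. t $ i + m)"
      by (intro member_le_sum) auto
    also have "\<dots> \<le> M + real CARD('n) * m"
      using assms(2) by (simp add: sum.distrib)
    finally have "t $ j \<le> \<bar>M\<bar> + real CARD('n) * m" using assms(3) by linarith
    moreover have "m \<le> real CARD('n) * m"
      using assms(3) mult_right_mono[of 1 "real CARD('n)" m] by (simp add: Suc_leI)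
    ultimately show ?thesis using assms(1)[of j] by linarith
  qed
  then have "(\<Sum>i\<in>UNIV. \<bar>t $ i\<bar>) \<le> real CARD('n) * (\<bar>M\<bar> + real CARD('n) * m)"
    by (rule sum_bounded_above[where A=UNIV, simplified])
  with norm_le_l1_cart[of t] show ?thesis by linarith
qed

text \<open>
  Witnesses \<open>(t, h)\<close> of a convergent sequence of perturbations are bounded: \<open>t\<close> is bounded below by
  \<open>e\<close> and its sum is \<open>s\<close>, while \<open>h\<close> is bounded below through the affine minorant of \<open>f\<close> and its
  sum is at most \<open>r\<close>. A limit point of the witnesses is a witness for the limit, since the epigraph
  of \<open>f\<close> is closed.
\<close>

lemma closed_perturbations:
  fixes z :: "real ^ 'n"
  assumes f: "proper_fun f" "convex_fun f" "lsc_fun f"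
  shows "closed (perturbations f z)"
  unfolding closed_sequential_limits
proof (intro allI impI)
  fix X p assume X: "(\<forall>k. X k \<in> perturbations f z) \<and> X \<longlonglongrightarrow> p"
  define s where "s = fst \<circ> X"
  define r where "r = fst \<circ> snd \<circ> X"
  define l where "l = fst \<circ> snd \<circ> snd \<circ> X"
  define e where "e = snd \<circ> snd \<circ> snd \<circ> X"
  have X_eq: "X k = (s k, r k, l k, e k)" for k
    by (simp add: s_def r_def l_def e_def)
  obtain s0 r0 l0 e0 where p: "p = (s0, r0, l0, e0)" by (cases p)
  have X_lim: "(\<lambda>k. (s k, r k, l k, e k)) \<longlonglongrightarrow> (s0, r0, l0, e0)"
    using X by (simp add: p flip: X_eq)
  have lims: "s \<longlonglongrightarrow> s0" "r \<longlonglongrightarrow> r0" "l \<longlonglongrightarrow> l0" "e \<longlonglongrightarrow> e0"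
    using tendsto_fst[OF X_lim] tendsto_fst[OF tendsto_snd[OF X_lim]]
      tendsto_fst[OF tendsto_snd[OF tendsto_snd[OF X_lim]]]
      tendsto_snd[OF tendsto_snd[OF tendsto_snd[OF X_lim]]]
    by simp_all
  have "\<forall>k. \<exists>t h. (\<forall>i. f (t $ i) \<le> ereal (h $ i)) \<and> s k = (\<Sum>i\<in>UNIV. t $ i) \<and>
      (\<Sum>i\<in>UNIV. h $ i) \<le> r k \<and> l k \<le> t \<bullet> z \<and> (\<forall>i. e k $ i \<le> t $ i)"
    using X X_eq by (auto simp: perturbations_def)
  then obtain t h where th: "\<And>k i. f (t k $ i) \<le> ereal (h k $ i)"
      "\<And>k. s k = (\<Sum>i\<in>UNIV. t k $ i)" "\<And>k. (\<Sum>i\<in>UNIV. h k $ i) \<le> r k"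
      "\<And>k. l k \<le> t k \<bullet> z" "\<And>k i. e k $ i \<le> t k $ i"
    by metis
  obtain y c where minorant: "\<And>x r. f x \<le> ereal r \<Longrightarrow> y * x - c \<le> r"
    using affine_minorant[OF f] by metis
  have bounded_seq: "\<exists>M\<ge>0. \<forall>k. norm (u k) \<le> M" if "u \<longlonglongrightarrow> u0"
    for u :: "nat \<Rightarrow> 'b::real_normed_vector" and u0
    using convergent_imp_Bseq[of u] that by (metis BseqE convergent_def less_imp_le)
  obtain Ms Mr Me where M: "\<And>k. \<bar>s k\<bar> \<le> Ms" "\<And>k. \<bar>r k\<bar> \<le> Mr" "\<And>k. norm (e k) \<le> Me" "Me \<ge> 0"
    using bounded_seq[OF lims(1)] bounded_seq[OF lims(2)] bounded_seq[OF lims(4)] by auto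
  define T where "T = real CARD('n) * (\<bar>Ms\<bar> + real CARD('n) * Me)"
  have T: "norm (t k) \<le> T" for k
    unfolding T_def
  proof (rule norm_le_of_lower_bound_and_sum)
    fix i show "- Me \<le> t k $ i"
      using th(5)[of k i] M(3)[of k] component_le_norm_cart[of "e k" i] by linarith
    show "(\<Sum>i\<in>UNIV. t k $ i) \<le> Ms" using M(1)[of k] th(2)[of k] by linarith
  qed (use M in auto)
  define H where "H = real CARD('n) * (\<bar>Mr\<bar> + real CARD('n) * (\<bar>y\<bar> * T + \<bar>c\<bar>))"
  have H: "norm (h k) \<le> H" for k
    unfolding H_def
  proof (rule norm_le_of_lower_bound_and_sum)
    fix i
    have "\<bar>y * t k $ i\<bar> \<le> \<bar>y\<bar> * T"
      unfolding abs_mult using T[of k] component_le_norm_cart[of "t k" i]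
      by (intro mult_left_mono) auto
    then show "- (\<bar>y\<bar> * T + \<bar>c\<bar>) \<le> h k $ i"
      using minorant[OF th(1)[of k i]] by linarith
  next
    show "(\<Sum>i\<in>UNIV. h k $ i) \<le> Mr" using M(2)[of k] th(3)[of k] by linarith
    show "0 \<le> \<bar>y\<bar> * T + \<bar>c\<bar>" using order_trans[OF norm_ge_zero T[of 0]] by simp
  qed
  have "bounded (range (\<lambda>k. (t k, h k)))"
  proof (rule boundedI)
    fix x assume "x \<in> range (\<lambda>k. (t k, h k))"
    then obtain k where "x = (t k, h k)" by blast
    then show "norm x \<le> T + H"
      using norm_Pair_le[of "t k" "h k"] T[of k] H[of k] by simp
  qed
  then obtain q \<phi> where \<phi>: "strict_mono (\<phi> :: nat \<Rightarrow> nat)" "((\<lambda>k. (t k, h k)) \<circ> \<phi>) \<longlonglongrightarrow> q"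
    using bounded_imp_convergent_subsequence by blast
  obtain t0 h0 where q: "q = (t0, h0)" by (cases q)
  have t_lim: "(\<lambda>k. t (\<phi> k)) \<longlonglongrightarrow> t0" and h_lim: "(\<lambda>k. h (\<phi> k)) \<longlonglongrightarrow> h0"
    using tendsto_fst[OF \<phi>(2)] tendsto_snd[OF \<phi>(2)] by (auto simp: q)
  note sub = LIMSEQ_subseq_LIMSEQ[OF _ \<phi>(1), unfolded o_def]
  have "(s0, r0, l0, e0) \<in> perturbations f z"
  proof (rule perturbationsI)
    fix i
    have "(\<lambda>k. (t (\<phi> k) $ i, h (\<phi> k) $ i)) \<longlonglongrightarrow> (t0 $ i, h0 $ i)"
      by (intro tendsto_intros t_lim h_lim)
    from closed_sequentially[OF closed_epi[OF f(3)] _ this] have "(t0 $ i, h0 $ i) \<in> epi f"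
      by (simp add: th)
    then show "f (t0 $ i) \<le> ereal (h0 $ i)" by simp
    show "e0 $ i \<le> t0 $ i"
      by (rule LIMSEQ_le[OF tendsto_vec_nth[OF sub[OF lims(4)]] tendsto_vec_nth[OF t_lim]])
        (use th in auto)
  next
    have "(\<lambda>k. \<Sum>i\<in>UNIV. t (\<phi> k) $ i) \<longlonglongrightarrow> (\<Sum>i\<in>UNIV. t0 $ i)"
      by (intro tendsto_intros t_lim)
    then show "s0 = (\<Sum>i\<in>UNIV. t0 $ i)"
      using sub[OF lims(1)] by (intro LIMSEQ_unique[of "\<lambda>k. s (\<phi> k)"]) (simp_all add: th(2))
    have "(\<lambda>k. \<Sum>i\<in>UNIV. h (\<phi> k) $ i) \<longlonglongrightarrow> (\<Sum>i\<in>UNIV. h0 $ i)"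
      by (intro tendsto_intros h_lim)
    then show "(\<Sum>i\<in>UNIV. h0 $ i) \<le> r0"
      by (rule LIMSEQ_le[OF _ sub[OF lims(2)]]) (use th in auto)
    have "(\<lambda>k. t (\<phi> k) \<bullet> z) \<longlonglongrightarrow> t0 \<bullet> z"
      by (intro tendsto_intros t_lim)
    then show "l0 \<le> t0 \<bullet> z"
      by (rule LIMSEQ_le[OF sub[OF lims(3)]]) (use th in auto)
  qed
  then show "p \<in> perturbations f z" by (simp add: p)
qed

section \<open>Existence of multipliers\<close>

lemma nonneg_of_ray_bounded_below:
  fixes A :: real
  assumes "\<And>\<tau>. \<tau> \<ge> 0 \<Longrightarrow> b < A + \<tau> * m"
  shows "m \<ge> 0"
proof (rule ccontr)
  assume "\<not> m \<ge> 0"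
  then have m: "m < 0" by simp
  have "b < A + (\<bar>A - b\<bar> / (- m)) * m"
    by (rule assms) (use m in \<open>simp add: divide_nonneg_neg\<close>)
  also have "\<dots> = A - \<bar>A - b\<bar>" using m by simp
  finally show False by linarith
qed

text \<open>
  The components \<open>r\<close>, \<open>l\<close> and \<open>e\<close> of a perturbation may be relaxed without limit, the first upwards
  and the other two downwards; this forces the signs of the coefficients of a separating functional.
\<close>

lemma separating_multipliers:
  fixes z :: "real ^ 'n"
  assumes f: "proper_fun f" "convex_fun f" "lsc_fun f"
    and infeasible: "(N, \<rho>, M, 0) \<notin> perturbations f z"
  obtains \<mu> \<nu> :: real and v :: "real ^ 'n" and c \<gamma> :: real
  where "\<mu> \<ge> 0" "\<nu> \<ge> 0" "\<forall>i. v $ i \<ge> 0" "c > 0"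
    "\<forall>t h. (\<forall>i. f (t $ i) \<le> ereal (h $ i)) \<longrightarrow>
       \<gamma> * N + \<mu> * \<rho> - \<nu> * M + c
         \<le> \<gamma> * (\<Sum>i\<in>UNIV. t $ i) + \<mu> * (\<Sum>i\<in>UNIV. h $ i) - \<nu> * (t \<bullet> z) - v \<bullet> t"
proof -
  obtain A b where Ab: "A \<bullet> (N, \<rho>, M, 0) < b" "\<forall>p\<in>perturbations f z. b < A \<bullet> p"
    using separating_hyperplane_closed_point[OF convex_perturbations[OF f(2)]
        closed_perturbations[OF f] infeasible] by blast
  obtain \<gamma> \<mu> \<nu> v where A: "A = (\<gamma>, \<mu>, \<nu>, v)" by (cases A)
  have sep: "b < \<gamma> * (\<Sum>i\<in>UNIV. t $ i) + \<mu> * r + \<nu> * l + v \<bullet> e"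
    if "\<And>i. f (t $ i) \<le> ereal (h $ i)" "(\<Sum>i\<in>UNIV. h $ i) \<le> r" "l \<le> t \<bullet> z" "\<And>i. e $ i \<le> t $ i"
    for t h e :: "real ^ 'n" and r l
    using Ab(2) perturbationsI[of f t h, OF that(1) refl that(2,3,4)] by (fastforce simp: A)
  obtain x1 r1 where x1: "f x1 = ereal r1"
    using proper_fun_finite_value[OF f(1)] .
  let ?t = "(\<chi> i. x1) :: real ^ 'n" and ?h = "(\<chi> i. r1) :: real ^ 'n"
  let ?s = "\<Sum>i\<in>UNIV. ?t $ i" and ?r = "\<Sum>i\<in>UNIV. ?h $ i"
  have "\<mu> \<ge> 0"
  proof (rule nonneg_of_ray_bounded_below)
    fix \<tau> :: real assume "\<tau> \<ge> 0"
    then show "b < (\<gamma> * ?s + \<mu> * ?r + \<nu> * (?t \<bullet> z) + v \<bullet> ?t) + \<tau> * \<mu>"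
      using sep[of ?t ?h "?r + \<tau>" "?t \<bullet> z" ?t] by (simp add: x1 algebra_simps)
  qed
  moreover have "- \<nu> \<ge> 0"
  proof (rule nonneg_of_ray_bounded_below)
    fix \<tau> :: real assume "\<tau> \<ge> 0"
    then show "b < (\<gamma> * ?s + \<mu> * ?r + \<nu> * (?t \<bullet> z) + v \<bullet> ?t) + \<tau> * (- \<nu>)"
      using sep[of ?t ?h "?r" "?t \<bullet> z - \<tau>" ?t] by (simp add: x1 algebra_simps)
  qed
  moreover have "\<forall>i. (- v) $ i \<ge> 0"
  proof (rule allI, rule nonneg_of_ray_bounded_below)
    fix i and \<tau> :: real assume "\<tau> \<ge> 0"
    then have "b < \<gamma> * ?s + \<mu> * ?r + \<nu> * (?t \<bullet> z) + v \<bullet> (?t - \<tau> *\<^sub>R axis i 1)"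
      by (intro sep[of ?t ?h]) (simp_all add: x1 axis_def)
    then show "b < (\<gamma> * ?s + \<mu> * ?r + \<nu> * (?t \<bullet> z) + v \<bullet> ?t) + \<tau> * (- v) $ i"
      by (simp add: inner_diff_right inner_axis)
  qed
  moreover have "b - (\<gamma> * N + \<mu> * \<rho> + \<nu> * M) > 0"
    using Ab(1) by (simp add: A)
  moreover have "\<forall>t h. (\<forall>i. f (t $ i) \<le> ereal (h $ i)) \<longrightarrow>
       \<gamma> * N + \<mu> * \<rho> - (- \<nu>) * M + (b - (\<gamma> * N + \<mu> * \<rho> + \<nu> * M))
         \<le> \<gamma> * (\<Sum>i\<in>UNIV. t $ i) + \<mu> * (\<Sum>i\<in>UNIV. h $ i) - (- \<nu>) * (t \<bullet> z) - (- v) \<bullet> t"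
  proof (intro allI impI)
    fix t h :: "real ^ 'n" assume "\<forall>i. f (t $ i) \<le> ereal (h $ i)"
    then show "\<gamma> * N + \<mu> * \<rho> - (- \<nu>) * M + (b - (\<gamma> * N + \<mu> * \<rho> + \<nu> * M))
         \<le> \<gamma> * (\<Sum>i\<in>UNIV. t $ i) + \<mu> * (\<Sum>i\<in>UNIV. h $ i) - (- \<nu>) * (t \<bullet> z) - (- v) \<bullet> t"
      using sep[of t h "\<Sum>i\<in>UNIV. h $ i" "t \<bullet> z" t] by simp
  qed
  ultimately show ?thesis
    by (rule that)
qed

text \<open>
  The functional added to the separating one takes its multipliers from the affine minorant
  \<open>f(t) \<ge> y t - k\<close>: giving weight one to objective and divergence and choosing
  \<open>\<gamma>0 = Z - y\<close>, \<open>v0 = Z - z\<close> with \<open>Z = max z\<close> turns it into \<open>\<Sum>(h\<^sub>i - y t\<^sub>i)\<close>, which is at least \<open>- n k\<close>.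
\<close>

lemma normalized_multipliers:
  fixes z :: "real ^ 'n"
  assumes f: "proper_fun f" "convex_fun f" "lsc_fun f"
    and infeasible: "(N, \<rho>, M, 0) \<notin> perturbations f z"
  obtains \<mu> :: real and v :: "real ^ 'n" and \<gamma> :: real
  where "\<mu> > 0" "\<forall>i. v $ i \<ge> 0"
    "\<forall>t h. (\<forall>i. f (t $ i) \<le> ereal (h $ i)) \<longrightarrow>
       (\<Sum>i\<in>UNIV. t $ i * (z $ i + v $ i - \<gamma>) - \<mu> * h $ i) \<le> M - \<gamma> * N - \<mu> * \<rho>"
proof -
  obtain \<mu> \<nu> v c \<gamma> where sep: "\<mu> \<ge> 0" "\<nu> \<ge> 0" "\<forall>i. v $ i \<ge> 0" "c > 0"
    "\<forall>t h. (\<forall>i. f (t $ i) \<le> ereal (h $ i)) \<longrightarrow>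
       \<gamma> * N + \<mu> * \<rho> - \<nu> * M + c
         \<le> \<gamma> * (\<Sum>i\<in>UNIV. t $ i) + \<mu> * (\<Sum>i\<in>UNIV. h $ i) - \<nu> * (t \<bullet> z) - v \<bullet> t"
    using separating_multipliers[OF f infeasible] .
  obtain y k where minorant: "\<And>x r. f x \<le> ereal r \<Longrightarrow> y * x - k \<le> r"
    using affine_minorant[OF f] by metis
  define Z where "Z = Max (range (($) z))"
  have Z: "z $ i \<le> Z" for i by (simp add: Z_def)
  define v0 where "v0 = (\<chi> i. Z - z $ i)"
  define \<gamma>0 where "\<gamma>0 = Z - y"
  have baseline: "- (real CARD('n) * k)
      \<le> \<gamma>0 * (\<Sum>i\<in>UNIV. t $ i) + (\<Sum>i\<in>UNIV. h $ i) - t \<bullet> z - v0 \<bullet> t"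
    if "\<And>i. f (t $ i) \<le> ereal (h $ i)" for t h
  proof -
    have "(\<Sum>i\<in>(UNIV :: 'n set). - k) \<le> (\<Sum>i\<in>UNIV. h $ i - y * t $ i)"
    proof (intro sum_mono)
      fix i show "- k \<le> h $ i - y * t $ i"
        using minorant[OF that, of i] by linarith
    qed
    also have "\<dots> = (\<Sum>i\<in>UNIV. \<gamma>0 * t $ i + h $ i - t $ i * z $ i - v0 $ i * t $ i)"
      by (simp add: v0_def \<gamma>0_def algebra_simps)
    also have "\<dots> = \<gamma>0 * (\<Sum>i\<in>UNIV. t $ i) + (\<Sum>i\<in>UNIV. h $ i) - t \<bullet> z - v0 \<bullet> t"
      by (simp add: inner_vec_def sum.distrib sum_subtractf sum_distrib_left)
    finally show ?thesis by simp
  qed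
  define D where "D = real CARD('n) * k + \<gamma>0 * N + \<rho> - M"
  \<comment> \<open>the added functional falls below its value at the unperturbed point by at most \<open>D\<close>;
     \<open>\<delta>\<close> is small enough for \<open>\<delta> D\<close> not to exceed the gap \<open>c\<close>\<close>
  define \<delta> where "\<delta> = c / (1 + \<bar>D\<bar>)"
  have \<delta>: "\<delta> > 0" unfolding \<delta>_def using sep(4) by (intro divide_pos_pos) linarith+
  have "\<delta> * D \<le> \<delta> * (1 + \<bar>D\<bar>)" using \<delta> by (intro mult_left_mono) auto
  also have "\<dots> = c" by (simp add: \<delta>_def)
  finally have \<delta>D: "\<delta> * D \<le> c" .
  define \<kappa> where "\<kappa> = \<nu> + \<delta>"
  have \<kappa>: "\<kappa> > 0" using \<delta> sep(2) by (simp add: \<kappa>_def)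
  have combined: "(\<gamma> + \<delta> * \<gamma>0) * N + (\<mu> + \<delta>) * \<rho> - \<kappa> * M
      \<le> (\<gamma> + \<delta> * \<gamma>0) * (\<Sum>i\<in>UNIV. t $ i) + (\<mu> + \<delta>) * (\<Sum>i\<in>UNIV. h $ i)
         - \<kappa> * (t \<bullet> z) - (v + \<delta> *\<^sub>R v0) \<bullet> t"
    if "\<And>i. f (t $ i) \<le> ereal (h $ i)" for t h
    using sep(5)[rule_format, OF that] mult_left_mono[OF baseline[OF that], of \<delta>] \<delta> \<delta>D
    by (simp add: \<kappa>_def D_def algebra_simps inner_add_left)
  show ?thesis
  proof (rule that[of "(\<mu> + \<delta>) / \<kappa>" "(1 / \<kappa>) *\<^sub>R (v + \<delta> *\<^sub>R v0)" "(\<gamma> + \<delta> * \<gamma>0) / \<kappa>"])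
    show "(\<mu> + \<delta>) / \<kappa> > 0" using \<kappa> \<delta> sep(1) by simp
    show "\<forall>i. ((1 / \<kappa>) *\<^sub>R (v + \<delta> *\<^sub>R v0)) $ i \<ge> 0"
      using \<kappa> \<delta> sep(3) Z by (simp add: v0_def)
  next
    have "(\<Sum>i\<in>UNIV. t $ i * (z $ i + ((1 / \<kappa>) *\<^sub>R (v + \<delta> *\<^sub>R v0)) $ i
        - (\<gamma> + \<delta> * \<gamma>0) / \<kappa>) - (\<mu> + \<delta>) / \<kappa> * h $ i)
        \<le> M - (\<gamma> + \<delta> * \<gamma>0) / \<kappa> * N - (\<mu> + \<delta>) / \<kappa> * \<rho>"
      if th: "\<And>i. f (t $ i) \<le> ereal (h $ i)" for t h
    proof -
      have "(\<Sum>i\<in>UNIV. t $ i * (z $ i + ((1 / \<kappa>) *\<^sub>R (v + \<delta> *\<^sub>R v0)) $ i - (\<gamma> + \<delta> * \<gamma>0) / \<kappa>)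
               - (\<mu> + \<delta>) / \<kappa> * h $ i)
          = (\<Sum>i\<in>UNIV. t $ i * z $ i) + 1 / \<kappa> * (\<Sum>i\<in>UNIV. (v + \<delta> *\<^sub>R v0) $ i * t $ i)
              - (\<gamma> + \<delta> * \<gamma>0) / \<kappa> * (\<Sum>i\<in>UNIV. t $ i) - (\<mu> + \<delta>) / \<kappa> * (\<Sum>i\<in>UNIV. h $ i)"
        unfolding sum_distrib_left sum.distrib[symmetric] sum_subtractf[symmetric]
        by (intro sum.cong refl) (simp add: algebra_simps)
      also have "\<dots> = t \<bullet> z + 1 / \<kappa> * ((v + \<delta> *\<^sub>R v0) \<bullet> t)
              - (\<gamma> + \<delta> * \<gamma>0) / \<kappa> * (\<Sum>i\<in>UNIV. t $ i) - (\<mu> + \<delta>) / \<kappa> * (\<Sum>i\<in>UNIV. h $ i)"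
        by (simp only: inner_vec_def inner_real_def)
      also have "\<dots> \<le> M - (\<gamma> + \<delta> * \<gamma>0) / \<kappa> * N - (\<mu> + \<delta>) / \<kappa> * \<rho>"
        using combined[OF th] \<kappa> by (simp add: divide_simps) (simp add: mult.commute)
      finally show ?thesis .
    qed
    then show "\<forall>t h. (\<forall>i. f (t $ i) \<le> ereal (h $ i)) \<longrightarrow>
       (\<Sum>i\<in>UNIV. t $ i * (z $ i + ((1 / \<kappa>) *\<^sub>R (v + \<delta> *\<^sub>R v0)) $ i
        - (\<gamma> + \<delta> * \<gamma>0) / \<kappa>) - (\<mu> + \<delta>) / \<kappa> * h $ i)
        \<le> M - (\<gamma> + \<delta> * \<gamma>0) / \<kappa> * N - (\<mu> + \<delta>) / \<kappa> * \<rho>"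
      by blast
  qed
qed

section \<open>Duality for a fixed vector of losses\<close>

lemma ambiguity_set_epi:
  fixes p :: "real ^ 'n"
  assumes "proper_fun f" "p \<in> ambiguity_set f \<rho>"
  obtains h :: "real ^ 'n" where "\<And>i. f (real CARD('n) * p $ i) = ereal (h $ i)"
    "(\<Sum>i\<in>UNIV. h $ i) \<le> \<rho>"
proof -
  let ?n = "real CARD('n)"
  have D: "(\<Sum>i\<in>UNIV. ereal (1 / ?n) * f (?n * p $ i)) \<le> ereal (\<rho> / ?n)"
    using assms(2) by (simp add: ambiguity_set_def f_divergence_def mult.commute)
  have fin: "f (?n * p $ i) \<noteq> \<infinity>" for i
  proof
    assume "f (?n * p $ i) = \<infinity>"
    then have "\<exists>i\<in>UNIV. ereal (1 / ?n) * f (?n * p $ i) = \<infinity>"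
      by (intro bexI[of _ i]) auto
    then have "(\<Sum>i\<in>UNIV. ereal (1 / ?n) * f (?n * p $ i)) = \<infinity>"
      unfolding sum_Pinfty by simp
    with D show False by simp
  qed
  define h where "h = (\<chi> i. real_of_ereal (f (?n * p $ i)))"
  have h: "f (?n * p $ i) = ereal (h $ i)" for i
    using fin[of i] assms(1) by (cases "f (?n * p $ i)") (auto simp: h_def proper_fun_def)
  have "(\<Sum>i\<in>UNIV. h $ i) \<le> \<rho>"
    using D by (simp add: h divide_simps flip: sum_divide_distrib)
  with h show ?thesis by (rule that)
qed

lemma mem_ambiguity_setI:
  fixes t h :: "real ^ 'n"
  assumes "\<And>i. f (t $ i) \<le> ereal (h $ i)" "(\<Sum>i\<in>UNIV. t $ i) = real CARD('n)"
    "(\<Sum>i\<in>UNIV. h $ i) \<le> \<rho>" "\<And>i. 0 \<le> t $ i"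
  shows "(1 / real CARD('n)) *\<^sub>R t \<in> ambiguity_set f \<rho>"
proof -
  let ?n = "real CARD('n)"
  have "(\<Sum>i\<in>UNIV. ereal (1 / ?n) * f (t $ i)) \<le> (\<Sum>i\<in>UNIV. ereal (1 / ?n) * ereal (h $ i))"
    using assms(1) by (intro sum_mono ereal_mult_left_mono) auto
  also have "\<dots> = ereal ((\<Sum>i\<in>UNIV. h $ i) / ?n)"
    by (simp add: sum_divide_distrib)
  also have "\<dots> \<le> ereal (\<rho> / ?n)"
    using assms(3) by (simp add: divide_right_mono)
  finally show ?thesis
    using assms(2,4) by (simp add: ambiguity_set_def f_divergence_def flip: sum_divide_distrib)
qed

text \<open>
  Fenchel--Young in each coordinate, \<open>n p\<^sub>i q\<^sub>i \<le> m f(n p\<^sub>i) + m f\<^sup>*(q\<^sub>i / m)\<close>, summed up. For \<open>m = 0\<close>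
  both sides vanish because then \<open>q = 0\<close>, and what remains is that an average of the \<open>z\<^sub>i\<close> is at most
  \<open>\<gamma>\<close> if all \<open>z\<^sub>i\<close> are.
\<close>

lemma weak_duality:
  fixes p z q w v :: "real ^ 'n"
  assumes f: "proper_fun f" and p: "p \<in> ambiguity_set f \<rho>" and m: "m \<ge> 0"
    and q: "\<And>i. z $ i \<le> q $ i + \<gamma>" "\<And>i. m = 0 \<Longrightarrow> q $ i = 0"
  shows "ereal (\<Sum>i\<in>UNIV. p $ i * z $ i)
     \<le> ereal (\<gamma> + \<rho> * m / real CARD('n))
        + ereal (1 / real CARD('n)) * (\<Sum>i\<in>UNIV. scaled (conjugate f) m (q $ i))"
proof -
  let ?n = "real CARD('n)"
  obtain h :: "real ^ 'n" where h: "\<And>i. f (?n * p $ i) = ereal (h $ i)" "(\<Sum>i\<in>UNIV. h $ i) \<le> \<rho>"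
    using ambiguity_set_epi[OF f p] by metis
  have p': "(\<Sum>i\<in>UNIV. p $ i) = 1" "\<And>i. 0 \<le> p $ i"
    using p by (auto simp: ambiguity_set_def)
  have scaled_ge: "ereal (?n * p $ i * q $ i - m * h $ i) \<le> scaled (conjugate f) m (q $ i)" for i
  proof (cases "m = 0")
    case True then show ?thesis using q(2)[of i] by (simp add: scaled_def)
  next
    case False
    have "ereal (?n * p $ i * q $ i - m * h $ i)
        = ereal m * ereal (q $ i / m * (?n * p $ i) - h $ i)"
      using False by (simp add: algebra_simps)
    also have "\<dots> \<le> ereal m * conjugate f (q $ i / m)"
      using m by (intro ereal_mult_left_mono conjugate_ge) (auto simp: h)
    finally show ?thesis using False by (simp add: scaled_def)
  qed
  have "(\<Sum>i\<in>UNIV. p $ i * z $ i) \<le> (\<Sum>i\<in>UNIV. p $ i * (q $ i + \<gamma>))"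
    using q(1) p'(2) by (intro sum_mono mult_left_mono)
  also have "\<dots> = (\<Sum>i\<in>UNIV. p $ i * q $ i) + \<gamma>"
    using p'(1) by (simp add: algebra_simps sum.distrib flip: sum_distrib_left)
  also have "\<dots> \<le> \<gamma> + \<rho> * m / ?n + 1 / ?n * (\<Sum>i\<in>UNIV. ?n * p $ i * q $ i - m * h $ i)"
  proof -
    have "1 / ?n * (\<Sum>i\<in>UNIV. ?n * p $ i * q $ i - m * h $ i)
        = (\<Sum>i\<in>UNIV. p $ i * q $ i) - m * (\<Sum>i\<in>UNIV. h $ i) / ?n"
      by (simp add: sum_subtractf right_diff_distrib diff_divide_distrib mult.assoc flip: sum_distrib_left)
    moreover have "m * (\<Sum>i\<in>UNIV. h $ i) / ?n \<le> \<rho> * m / ?n"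
      using mult_left_mono[OF h(2) m] by (intro divide_right_mono) (simp_all add: mult.commute)
    ultimately show ?thesis by linarith
  qed
  finally have "ereal (\<Sum>i\<in>UNIV. p $ i * z $ i)
      \<le> ereal (\<gamma> + \<rho> * m / ?n) + ereal (1 / ?n) * (\<Sum>i\<in>UNIV. ereal (?n * p $ i * q $ i - m * h $ i))"
    by simp
  also have "\<dots> \<le> ereal (\<gamma> + \<rho> * m / ?n)
        + ereal (1 / ?n) * (\<Sum>i\<in>UNIV. scaled (conjugate f) m (q $ i))"
    using scaled_ge by (intro add_mono ereal_mult_left_mono sum_mono order_refl) auto
  finally show ?thesis .
qed

text \<open>
  A strict upper bound \<open>L\<close> of the primal values makes the system with objective level \<open>L\<close>
  infeasible; the resulting Lagrangian bound is separable in \<open>t\<close>, so it passes to the conjugates.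
  An empty ambiguity set is included: every \<open>L\<close> is then admissible and the dual is unbounded below.
\<close>

lemma strong_duality:
  fixes z :: "real ^ 'n"
  assumes f: "proper_fun f" "convex_fun f" "lsc_fun f"
    and less: "\<And>p :: real ^ 'n. p \<in> ambiguity_set f \<rho> \<Longrightarrow> (\<Sum>i\<in>UNIV. p $ i * z $ i) < L"
  obtains m :: real and v :: "real ^ 'n" and \<gamma> :: real
  where "m > 0" "\<forall>i. v $ i \<ge> 0" "\<forall>i. (z $ i + v $ i - \<gamma>) / m \<in> edom (conjugate f)"
    "ereal (\<gamma> + \<rho> * m / real CARD('n))
        + ereal (1 / real CARD('n)) * (\<Sum>i\<in>UNIV. scaled (conjugate f) m (z $ i + v $ i - \<gamma>))
      \<le> ereal L"
proof -
  let ?n = "real CARD('n)"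
  have infeasible: "(?n, \<rho>, ?n * L, 0) \<notin> perturbations f z"
  proof
    assume "(?n, \<rho>, ?n * L, 0) \<in> perturbations f z"
    then obtain t h :: "real ^ 'n" where th: "\<And>i. f (t $ i) \<le> ereal (h $ i)"
        "?n = (\<Sum>i\<in>UNIV. t $ i)" "(\<Sum>i\<in>UNIV. h $ i) \<le> \<rho>" "?n * L \<le> t \<bullet> z" "\<And>i. 0 \<le> t $ i"
      by (elim perturbationsE) (auto simp: zero_vec_def)
    have "(1 / ?n) *\<^sub>R t \<in> ambiguity_set f \<rho>"
      using th by (intro mem_ambiguity_setI) auto
    from less[OF this] have "(t \<bullet> z) / ?n < L"
      by (simp add: inner_vec_def sum_divide_distrib)
    with th(4) show False by (simp add: field_simps)
  qed
  obtain m v \<gamma> where mult: "m > 0" "\<forall>i. v $ i \<ge> 0"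
    "\<forall>t h. (\<forall>i. f (t $ i) \<le> ereal (h $ i)) \<longrightarrow>
       (\<Sum>i\<in>UNIV. t $ i * (z $ i + v $ i - \<gamma>) - m * h $ i) \<le> ?n * L - \<gamma> * ?n - m * \<rho>"
    using normalized_multipliers[OF f infeasible] .
  define y where "y = (\<chi> i. (z $ i + v $ i - \<gamma>) / m)"
  have y_bound: "(\<Sum>i\<in>UNIV. y $ i * t $ i - h $ i) \<le> (?n * L - \<gamma> * ?n - m * \<rho>) / m"
    if "\<And>i. f (t $ i) \<le> ereal (h $ i)" for t h
  proof -
    have "(\<Sum>i\<in>UNIV. y $ i * t $ i - h $ i)
        = (\<Sum>i\<in>UNIV. t $ i * (z $ i + v $ i - \<gamma>) - m * h $ i) / m"
      unfolding sum_divide_distrib using mult(1)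
      by (intro sum.cong refl) (simp add: y_def field_simps)
    also have "\<dots> \<le> (?n * L - \<gamma> * ?n - m * \<rho>) / m"
      using mult(1) by (intro divide_right_mono mult(3)[rule_format, OF that]) auto
    finally show ?thesis .
  qed
  obtain F where F: "\<And>i. conjugate f (y $ i) = ereal (F $ i)"
      "(\<Sum>i\<in>UNIV. F $ i) \<le> (?n * L - \<gamma> * ?n - m * \<rho>) / m"
    using sum_conjugate_le[OF f(1), of y, OF y_bound] by metis
  show ?thesis
  proof (rule that[OF mult(1,2)])
    show "\<forall>i. (z $ i + v $ i - \<gamma>) / m \<in> edom (conjugate f)"
      using F(1) by (simp add: edom_def y_def)
  next
    have "scaled (conjugate f) m (z $ i + v $ i - \<gamma>) = ereal (m * F $ i)" for i
      using F(1)[of i] mult(1) by (simp add: scaled_def y_def)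
    then show "ereal (\<gamma> + \<rho> * m / ?n)
        + ereal (1 / ?n) * (\<Sum>i\<in>UNIV. scaled (conjugate f) m (z $ i + v $ i - \<gamma>)) \<le> ereal L"
      using F(2) mult(1) by (simp add: field_simps flip: sum_distrib_left)
  qed
qed

section \<open>The reformulation\<close>

theorem theorem3:
  fixes a :: "'n::finite \<Rightarrow> real ^ 'd"
    and b :: "real ^ 'n"
    and g :: "real \<Rightarrow> real"
    and f :: "real \<Rightarrow> ereal"
    and \<rho> :: real
    and X :: "(real ^ 'd) set"
    and i1 :: 'n  \<comment> \<open>the index called 1; \<open>n = CARD('n)\<close>\<close>
  assumes "\<And>i. b $ i \<in> {1, -1}"
    and "convex_on UNIV g"
    and "proper_fun f" and "convex_fun f" and "lsc_fun f"
    and "compact X" and "convex X"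
  shows
    "(INF x\<in>X. SUP p\<in>(ambiguity_set f \<rho> :: (real ^ 'n) set).
        ereal (\<Sum>i\<in>UNIV. p $ i * g (b $ i * (a i \<bullet> x))))
     = Inf {ereal (\<gamma> + \<rho> * \<mu> $ i1 / real CARD('n))
              + ereal (1 / real CARD('n)) * (\<Sum>i\<in>UNIV. scaled (conjugate f) (\<mu> $ i) (q $ i))
            | (x :: real ^ 'd) (u :: real ^ 'n) (v :: real ^ 'n) (w :: real ^ 'n)
              (\<mu> :: real ^ 'n) (q :: real ^ 'n) (\<gamma> :: real).
              w + v - q - \<gamma> *\<^sub>R 1 = 0 \<and>
              (\<forall>i. u $ i = b $ i * (a i \<bullet> x)) \<and>
              (\<forall>i j. \<mu> $ i = \<mu> $ j) \<and>
              (\<forall>i. g (u $ i) \<le> w $ i) \<and>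
              (\<forall>i. q $ i \<in> (\<lambda>y. \<mu> $ i * y) ` edom (conjugate f)) \<and>
              (\<forall>i. 0 \<le> v $ i \<and> 0 \<le> \<mu> $ i) \<and>
              x \<in> X}"
    (is "?primal = Inf ?values")
proof (rule antisym)
  show "?primal \<le> Inf ?values"
  proof (rule Inf_greatest)
    fix c assume "c \<in> ?values"
    then show "?primal \<le> c"
    proof (elim CollectE exE conjE)
      fix x :: "real ^ 'd" and u v w \<mu> q :: "real ^ 'n" and \<gamma> :: real
      assume c: "c = ereal (\<gamma> + \<rho> * \<mu> $ i1 / real CARD('n))
          + ereal (1 / real CARD('n)) * (\<Sum>i\<in>UNIV. scaled (conjugate f) (\<mu> $ i) (q $ i))"
        and balance: "w + v - q - \<gamma> *\<^sub>R 1 = 0"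
        and u: "\<forall>i. u $ i = b $ i * (a i \<bullet> x)"
        and \<mu>_eq: "\<forall>i j. \<mu> $ i = \<mu> $ j"
        and w: "\<forall>i. g (u $ i) \<le> w $ i"
        and q: "\<forall>i. q $ i \<in> (\<lambda>y. \<mu> $ i * y) ` edom (conjugate f)"
        and nonneg: "\<forall>i. 0 \<le> v $ i \<and> 0 \<le> \<mu> $ i"
        and x: "x \<in> X"
      define z where "z = (\<chi> i. g (b $ i * (a i \<bullet> x)))"
      have z_le: "z $ i \<le> q $ i + \<gamma>" for i
      proof -
        have "(w + v - q - \<gamma> *\<^sub>R 1) $ i = 0" using balance by simp
        then show ?thesis using w[rule_format, of i] nonneg[rule_format, of i] by (simp add: z_def u)
      qed
      have q0: "q $ i = 0" if "\<mu> $ i1 = 0" for i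
        using q[rule_format, of i] \<mu>_eq[rule_format, of i i1] that by auto
      define m where "m = \<mu> $ i1"
      have \<mu>_const: "\<mu> $ i = m" for i unfolding m_def by (rule \<mu>_eq[rule_format])
      have "(SUP p\<in>(ambiguity_set f \<rho> :: (real ^ 'n) set). ereal (\<Sum>i\<in>UNIV. p $ i * z $ i)) \<le> c"
        unfolding c \<mu>_const
      proof (rule SUP_least)
        fix p :: "real ^ 'n" assume "p \<in> ambiguity_set f \<rho>"
        then show "ereal (\<Sum>i\<in>UNIV. p $ i * z $ i) \<le> ereal (\<gamma> + \<rho> * m / real CARD('n))
            + ereal (1 / real CARD('n)) * (\<Sum>i\<in>UNIV. scaled (conjugate f) m (q $ i))"
          by (rule weak_duality[OF assms(3)]) (simp_all add: z_le q0 nonneg m_def)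
      qed
      then have sup_le: "(SUP p\<in>(ambiguity_set f \<rho> :: (real ^ 'n) set).
          ereal (\<Sum>i\<in>UNIV. p $ i * g (b $ i * (a i \<bullet> x)))) \<le> c"
        by (simp add: z_def)
      show "?primal \<le> c" by (rule INF_lower2[OF x]) (rule sup_le)
    qed
  qed
next
  show "Inf ?values \<le> ?primal"
  proof (rule INF_greatest)
    fix x assume x: "x \<in> X"
    define z where "z = (\<chi> i. g (b $ i * (a i \<bullet> x)))"
    have "Inf ?values \<le> (SUP p\<in>(ambiguity_set f \<rho> :: (real ^ 'n) set). ereal (\<Sum>i\<in>UNIV. p $ i * z $ i))"
      (is "_ \<le> ?sup")
    \<comment> \<open>the dual infimum need not be attained, so it is compared with every level above the supremum\<close>
    proof (rule dense_ge)
      fix c assume c: "?sup < c"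
      show "Inf ?values \<le> c"
      proof (cases c)
        case (real L)
        have less: "(\<Sum>i\<in>UNIV. p $ i * z $ i) < L" if "p \<in> ambiguity_set f \<rho>" for p :: "real ^ 'n"
        proof -
          have "ereal (\<Sum>i\<in>UNIV. p $ i * z $ i) \<le> ?sup"
            using that by (rule SUP_upper)
          also have "\<dots> < ereal L" using c unfolding real .
          finally show ?thesis by simp
        qed
        obtain m and v :: "real ^ 'n" and \<gamma> where dual: "m > 0" "\<forall>i. v $ i \<ge> 0"
          "\<forall>i. (z $ i + v $ i - \<gamma>) / m \<in> edom (conjugate f)"
          "ereal (\<gamma> + \<rho> * m / real CARD('n)) + ereal (1 / real CARD('n))
              * (\<Sum>i\<in>UNIV. scaled (conjugate f) m (z $ i + v $ i - \<gamma>)) \<le> ereal L"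
          using strong_duality[OF assms(3-5) less] .
        define q where "q = (\<chi> i. z $ i + v $ i - \<gamma>)"
        define \<mu> where "\<mu> = (\<chi> i::'n. m)"
        have "ereal (\<gamma> + \<rho> * \<mu> $ i1 / real CARD('n)) + ereal (1 / real CARD('n))
              * (\<Sum>i\<in>UNIV. scaled (conjugate f) (\<mu> $ i) (q $ i)) \<in> ?values"
        proof -
          have member: "q $ i \<in> (\<lambda>y. \<mu> $ i * y) ` edom (conjugate f)" for i
            using dual(1,3) by (intro image_eqI[of _ _ "q $ i / m"]) (auto simp: q_def \<mu>_def)
          have balance: "z + v - q - \<gamma> *\<^sub>R 1 = 0" by (simp add: vec_eq_iff q_def)
          show ?thesis
            by (rule CollectI, rule exI[of _ x], rule exI[of _ "\<chi> i. b $ i * (a i \<bullet> x)"],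
                rule exI[of _ v], rule exI[of _ z], rule exI[of _ \<mu>], rule exI[of _ q],
                rule exI[of _ \<gamma>], intro conjI allI refl balance member x)
              (use dual(1,2) in \<open>simp_all add: z_def \<mu>_def\<close>)
        qed
        then show ?thesis
          using dual(4) by (intro Inf_lower2) (auto simp: real q_def \<mu>_def)
      qed (use c in auto)
    qed
    then show "Inf ?values \<le> (SUP p\<in>(ambiguity_set f \<rho> :: (real ^ 'n) set).
        ereal (\<Sum>i\<in>UNIV. p $ i * g (b $ i * (a i \<bullet> x))))"
      by (simp add: z_def)
  qed
qed

end
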